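(* Let $G$ be a finite $d$-regular graph with vertex set $V$ and edge set $E$. Let $Z_1,\ldots,Z_m$ be independent random variables and let a subset $W_i\subseteq V$ be given for each $i=1,\ldots,m$. For each vertex $v\in V$ let $X_v$ be a random variable taking values in a finite set that is a measurable function of those $Z_i$ for which $v\in W_i$. Then $$\sum_{\{u,v\}\in E} H(X_u,X_v)\ \ge\ \beta\sum_{v\in V}H(X_v),\qquad\text{where}\quad \beta=\frac12\left(d+\min_{1\le i\le m;\ W\subseteq W_i}\frac{|\partial W|}{|W|}\right).$$
   Context: $H$ denotes Shannon entropy: for a discrete random variable taking values with probabilities $p_1,\ldots,p_k$, it is $\sum_j -p_j\log p_j$; $H(X_u,X_v)$ is the entropy of the joint distribution of $(X_u,X_v)$. For $W\subseteq V$, $\partial W$ is the edge boundary of $W$: the set of edges with one endpoint in $W$ and one endpoint outside $W$. The minimum is over all pairs $(i,W)$ with $W$ a nonempty subset of $W_i$; at least one $W_i$ is nonempty so that such pairs exist. The $Z_i$ may take values in arbitrary measurable spaces. *)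

theory Defs
  imports "HOL-Probability.Probability"
begin

definition simple_graph :: "'v set \<Rightarrow> 'v set set \<Rightarrow> bool" where
  "simple_graph V E \<longleftrightarrow> (\<forall>e\<in>E. \<exists>u\<in>V. \<exists>v\<in>V. u \<noteq> v \<and> e = {u, v})"

definition regular_graph :: "nat \<Rightarrow> 'v set \<Rightarrow> 'v set set \<Rightarrow> bool" where
  "regular_graph d V E \<longleftrightarrow>
     finite V \<and> simple_graph V E \<and> (\<forall>v\<in>V. card {e \<in> E. v \<in> e} = d)"

definition edge_boundary :: "'v set set \<Rightarrow> 'v set \<Rightarrow> 'v set set" where
  "edge_boundary E W = {e \<in> E. \<exists>u v. e = {u, v} \<and> u \<in> W \<and> v \<notin> W}"

(* The sum over {u,v} in E of f u v. It is meaningful only for f symmetric on the edges, in which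
   case the description below denotes the common value of f u v and f v u (edge_value_eq). *)
definition edge_sum :: "'v set set \<Rightarrow> ('v \<Rightarrow> 'v \<Rightarrow> real) \<Rightarrow> real" where
  "edge_sum E f = (\<Sum>e\<in>E. THE y. \<exists>u v. e = {u, v} \<and> y = f u v)"

(* The notation \<H>(X) of information_space, made available outside that locale. By
   shannon_entropy_eq it is the sum of - p log p over the values of X. *)
definition shannon_entropy :: "real \<Rightarrow> 'a measure \<Rightarrow> ('a \<Rightarrow> 'c) \<Rightarrow> real" where
  "shannon_entropy b M X = prob_space.entropy M b (count_space (X ` space M)) X"

lemma edge_value_eq:
  fixes f :: "'v \<Rightarrow> 'v \<Rightarrow> real"
  assumes "f u v = f v u"
  shows "(THE y. \<exists>u' v'. {u, v} = {u', v'} \<and> y = f u' v') = f u v"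
  using assms by (intro the_equality) (auto simp: doubleton_eq_iff)

context information_space
begin

lemma shannon_entropy_eq:
  assumes "simple_function M X"
  shows "shannon_entropy b M X =
    (\<Sum>x\<in>X ` space M. - prob {\<omega> \<in> space M. X \<omega> = x} * log b (prob {\<omega> \<in> space M. X \<omega> = x}))"
proof -
  have eq: "X -` {x} \<inter> space M = {\<omega> \<in> space M. X \<omega> = x}" for x
    by auto
  have "simple_distributed M X (\<lambda>x. prob (X -` {x} \<inter> space M))"
    by (rule simple_distributedI[OF assms]) auto
  from entropy_simple_distributed[OF this] show ?thesis
    by (simp add: shannon_entropy_def eq sum_negf)
qed

lemma shannon_entropy_Pair_commute:
  assumes X: "simple_function M X" and Y: "simple_function M Y"
  shows "shannon_entropy b M (\<lambda>\<omega>. (X \<omega>, Y \<omega>)) = shannon_entropy b M (\<lambda>\<omega>. (Y \<omega>, X \<omega>))"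
proof -
  have im: "(\<lambda>\<omega>. (X \<omega>, Y \<omega>)) ` space M = prod.swap ` (\<lambda>\<omega>. (Y \<omega>, X \<omega>)) ` space M"
    by (auto simp: image_image)
  have "{\<omega> \<in> space M. (X \<omega>, Y \<omega>) = prod.swap y} = {\<omega> \<in> space M. (Y \<omega>, X \<omega>) = y}" for y
    by (cases y) auto
  then show ?thesis
    by (simp only: shannon_entropy_eq[OF simple_function_Pair[OF X Y]]
        shannon_entropy_eq[OF simple_function_Pair[OF Y X]] im sum.reindex[OF inj_swap] o_def)
qed

end

end

theory Submission
  imports Defs
begin

text \<open>
  The sources are revealed one at a time, and the inequality is proved separately for the amount of
  entropy that each source accounts for. Let \<open>a v\<close> be the mutual information of \<open>X v\<close> and \<open>Z i\<close>, given
  the sources revealed earlier. Three facts about it carry the proof.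

  First, the \<open>a v\<close> are nonnegative and vanish outside \<open>W i\<close>, and over all sources they add up to the
  entropy of \<open>X v\<close>, because nothing is left once all sources are known.

  Second, the pair \<open>(X u, X v)\<close> has at least as much information about \<open>Z i\<close> as each component
  (\<open>info_gain_pair_ge_fst\<close>), so an edge loses at least \<open>max (a u) (a v)\<close>. This rests on the convexity of
  \<open>(p, q) \<mapsto> p log (p / q)\<close> (\<open>integral_rel_entropy_ge\<close>).

  Third, for nonnegative weights \<open>a\<close> supported on \<open>W i\<close> the sum of \<open>max (a u) (a v)\<close> over the edges is at
  least \<open>\<beta>\<close> times the sum of the \<open>a v\<close>. For the indicator of a set \<open>U\<close> this says that the edges meeting
  \<open>U\<close>, of which there are \<open>(d * card U + card (edge_boundary E U)) / 2\<close> by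
  \<open>regular_graph_boundary_count\<close>, number at least \<open>\<beta> * card U\<close>; the general case follows by cutting \<open>a\<close>
  into layers (\<open>layer_cake_edge_max\<close>).

  As the sources take values in arbitrary spaces, their own entropy makes no sense, and only the
  finite-valued variables are given an entropy. Passing to the joint law of the sources, a product
  measure, turns conditioning on a source into fixing one coordinate, and conditional entropies into
  ordinary integrals over that coordinate. The revealing of the sources is then an induction on the
  number of coordinates (\<open>product_entropy_inequality\<close>).
\<close>

section \<open>Jensen inequality for relative entropy\<close>

text \<open>
  The function \<open>(p, q) \<mapsto> p log (p / q)\<close> is convex and homogeneous of degree 1; the left-hand side is
  its tangent plane at \<open>(P, Q)\<close>. Everything reduces to \<open>ln r \<le> r - 1\<close> for \<open>r = q P / (p Q)\<close>.
\<close>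

lemma tangent_rel_entropy:
  fixes p q P Q b :: real
  assumes "1 < b" "0 \<le> p" "p \<le> q" "0 < P" "P \<le> Q"
  shows "p * (log b P - log b Q) + (p - q * (P / Q)) / ln b \<le> p * (log b p - log b q)"
proof (cases "p = 0")
  case True
  then show ?thesis using assms by (simp add: divide_nonpos_pos)
next
  case False
  then have pos: "0 < p" "0 < q" "0 < Q" using assms by auto
  define r where "r = q * P / (p * Q)"
  have r: "0 < r" using pos assms by (simp add: r_def)
  have "ln r \<le> r - 1" by (rule ln_le_minus_one[OF r])
  then have "p * ln r \<le> p * (r - 1)" using pos by simp
  moreover have "ln r = ln q + ln P - ln p - ln Q"
    using pos assms by (simp add: r_def ln_div ln_mult)
  moreover have "p * (r - 1) = q * (P / Q) - p"
    using pos by (simp add: r_def field_simps)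
  ultimately have "p * (ln P - ln Q) + (p - q * (P / Q)) \<le> p * (ln p - ln q)"
    by (simp add: algebra_simps)
  then have "(p * (ln P - ln Q) + (p - q * (P / Q))) / ln b \<le> (p * (ln p - ln q)) / ln b"
    using assms by (intro divide_right_mono) auto
  then show ?thesis by (simp add: log_def add_divide_distrib diff_divide_distrib right_diff_distrib)
qed

text \<open>
  This bound is what makes all entropy integrands below integrable, although \<open>log b q\<close> itself is
  unbounded near 0.
\<close>

lemma abs_mult_log_le:
  fixes p q b :: real
  assumes "1 < b" "0 \<le> p" "p \<le> q" "q \<le> 1"
  shows "\<bar>p * log b q\<bar> \<le> 1 / ln b"
proof (cases "q = 0")
  case True
  then show ?thesis using assms by simp
next
  case False
  then have q: "0 < q" using assms by auto
  have "1 - 1 / q \<le> ln q" using ln_le_minus_one[of "1 / q"] q by (simp add: ln_div)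
  then have "q * (1 - 1 / q) \<le> q * ln q" using q by simp
  then have *: "- 1 \<le> q * ln q" using q by (simp add: algebra_simps)
  have "ln q \<le> 0" using q assms by simp
  then have "\<bar>p * ln q\<bar> = p * (- ln q)" using assms by (simp add: abs_mult)
  also have "\<dots> \<le> q * (- ln q)" using \<open>ln q \<le> 0\<close> assms by (intro mult_right_mono) auto
  also have "\<dots> \<le> 1" using * by simp
  finally have "\<bar>p * ln q\<bar> / ln b \<le> 1 / ln b"
    using assms by (intro divide_right_mono) auto
  then show ?thesis using assms by (simp add: log_def abs_mult)
qed

context prob_space
begin

lemma integrable_mult_log:
  assumes "1 < b" and [measurable]: "p \<in> borel_measurable M" "q \<in> borel_measurable M"
    and "\<And>x. x \<in> space M \<Longrightarrow> 0 \<le> p x \<and> p x \<le> q x \<and> q x \<le> 1"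
  shows "integrable M (\<lambda>x. p x * log b (q x))"
  using assms abs_mult_log_le[OF assms(1)]
  by (intro integrable_const_bound[where B="1 / ln b"]) (auto simp: log_def intro!: AE_I2)

text \<open>
  Jensen's inequality for the convex function \<open>(p, q) \<mapsto> p log (p / q)\<close> of two variables: integrate the
  tangent plane at the point of means. The correction term has integral 0 there.
\<close>

lemma integral_rel_entropy_ge:
  assumes b: "1 < b" and [measurable]: "p \<in> borel_measurable M" "q \<in> borel_measurable M"
    and pq: "\<And>x. x \<in> space M \<Longrightarrow> 0 \<le> p x \<and> p x \<le> q x \<and> q x \<le> 1"
  shows "expectation p * (log b (expectation p) - log b (expectation q))
    \<le> (\<integral>x. p x * (log b (p x) - log b (q x)) \<partial>M)"
proof -
  have ip: "integrable M p" using pq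
    by (intro integrable_const_bound[where B=1]) (force intro!: AE_I2)+
  have iq: "integrable M q" using pq
    by (intro integrable_const_bound[where B=1]) (force intro!: AE_I2)+
  have i1: "integrable M (\<lambda>x. p x * log b (p x))"
    by (rule integrable_mult_log[OF b]) (use pq in force)+
  have i2: "integrable M (\<lambda>x. p x * log b (q x))"
    by (rule integrable_mult_log[OF b]) (use pq in force)+
  have i: "integrable M (\<lambda>x. p x * (log b (p x) - log b (q x)))"
    using Bochner_Integration.integrable_diff[OF i1 i2] by (simp add: right_diff_distrib)
  have P0: "0 \<le> expectation p" using pq by (intro integral_nonneg_AE) (auto intro!: AE_I2)
  have PQ: "expectation p \<le> expectation q" using pq by (intro integral_mono ip iq) auto
  let ?P = "expectation p" and ?Q = "expectation q"
  show ?thesis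
    \<comment> \<open>There is no tangent plane at \<open>P = 0\<close>; but then \<open>p\<close> vanishes almost everywhere.\<close>
  proof (cases "?P = 0")
    case True
    then have "AE x in M. p x = 0"
      using integral_nonneg_eq_0_iff_AE[OF ip] pq by (auto intro!: AE_I2)
    then have "(\<integral>x. p x * (log b (p x) - log b (q x)) \<partial>M) = (\<integral>x. 0 \<partial>M)"
      by (intro integral_cong_AE) (auto simp: log_def)
    then show ?thesis using True by simp
  next
    case False
    then have P: "0 < ?P" using P0 by simp
    have "?P * (log b ?P - log b ?Q) = (\<integral>x. p x * (log b ?P - log b ?Q) + (p x - q x * (?P / ?Q)) / ln b \<partial>M)"
      using P PQ ip iq by simp
    also have "\<dots> \<le> (\<integral>x. p x * (log b (p x) - log b (q x)) \<partial>M)"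
      using ip iq i tangent_rel_entropy[OF b _ _ P PQ] pq
      by (intro integral_mono) auto
    finally show ?thesis .
  qed
qed

end

section \<open>Entropy of finite-valued functions\<close>

text \<open>
  The values are summed over a prescribed finite set \<open>S\<close>, not over the range of \<open>Y\<close>: once some
  coordinates are frozen the range shrinks, while \<open>S\<close> stays, so sums over \<open>S\<close> can be exchanged with
  integrals over the frozen coordinates. Points outside the range contribute 0.
\<close>

definition entropy_over :: "real \<Rightarrow> 'a measure \<Rightarrow> 'c set \<Rightarrow> ('a \<Rightarrow> 'c) \<Rightarrow> real" where
  "entropy_over b M S Y =
     (\<Sum>x\<in>S. - measure M {\<omega> \<in> space M. Y \<omega> = x} * log b (measure M {\<omega> \<in> space M. Y \<omega> = x}))"

context prob_space
begin

lemma prob_eq_sum_joint: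
  assumes Y1: "Y1 \<in> measurable M (count_space S1)" and Y2: "Y2 \<in> measurable M (count_space S2)"
    and "finite S2" "x \<in> S1"
  shows "prob {\<omega> \<in> space M. Y1 \<omega> = x} = (\<Sum>y\<in>S2. prob {\<omega> \<in> space M. (Y1 \<omega>, Y2 \<omega>) = (x, y)})"
proof -
  have "{\<omega> \<in> space M. Y1 \<omega> = x} = (\<Union>y\<in>S2. {\<omega> \<in> space M. (Y1 \<omega>, Y2 \<omega>) = (x, y)})"
    using measurable_space[OF Y2] by auto
  moreover have "{\<omega> \<in> space M. (Y1 \<omega>, Y2 \<omega>) = (x, y)} \<in> events" if "y \<in> S2" for y
  proof -
    have "{\<omega> \<in> space M. (Y1 \<omega>, Y2 \<omega>) = (x, y)} = (Y1 -` {x} \<inter> space M) \<inter> (Y2 -` {y} \<inter> space M)"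
      by auto
    also have "\<dots> \<in> events"
      by (intro sets.Int measurable_sets[OF Y1] measurable_sets[OF Y2]) (use assms that in auto)
    finally show ?thesis .
  qed
  ultimately show ?thesis using \<open>finite S2\<close>
    by (simp only:) (rule finite_measure_finite_Union, auto simp: disjoint_family_on_def)
qed

text \<open>
  The chain rule \<open>H(Y1, Y2) - H(Y1) = H(Y2 | Y1)\<close>. Each term is \<open>p log (p / q)\<close>, written as
  a difference of logarithms, the form that the Jensen inequality above uses.
\<close>

lemma entropy_over_chain:
  assumes Y: "Y1 \<in> measurable M (count_space S1)" "Y2 \<in> measurable M (count_space S2)"
    and fin: "finite S2"
  shows "entropy_over b M (S1 \<times> S2) (\<lambda>\<omega>. (Y1 \<omega>, Y2 \<omega>)) - entropy_over b M S1 Y1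
    = - (\<Sum>(x, y)\<in>S1 \<times> S2. prob {\<omega> \<in> space M. (Y1 \<omega>, Y2 \<omega>) = (x, y)}
          * (log b (prob {\<omega> \<in> space M. (Y1 \<omega>, Y2 \<omega>) = (x, y)}) - log b (prob {\<omega> \<in> space M. Y1 \<omega> = x})))"
proof -
  let ?p = "\<lambda>x y. prob {\<omega> \<in> space M. (Y1 \<omega>, Y2 \<omega>) = (x, y)}"
  let ?q = "\<lambda>x. prob {\<omega> \<in> space M. Y1 \<omega> = x}"
  have "entropy_over b M S1 Y1 = (\<Sum>x\<in>S1. \<Sum>y\<in>S2. - ?p x y * log b (?q x))"
    unfolding entropy_over_def
  proof (rule sum.cong[OF refl])
    fix x assume "x \<in> S1"
    show "- ?q x * log b (?q x) = (\<Sum>y\<in>S2. - ?p x y * log b (?q x))"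
      by (subst (1) prob_eq_sum_joint[OF Y fin \<open>x \<in> S1\<close>])
         (simp add: sum_distrib_right sum_negf)
  qed
  also have "\<dots> = (\<Sum>(x, y)\<in>S1 \<times> S2. - ?p x y * log b (?q x))"
    by (simp only: sum.cartesian_product)
  finally show ?thesis
    by (simp only: entropy_over_def sum_subtractf[symmetric] sum_negf[symmetric])
       (auto intro!: sum.cong simp: algebra_simps)
qed

end

lemma measurable_Pair_count_space:
  assumes "F \<in> measurable M (count_space S)" "G \<in> measurable M (count_space T)"
    and "finite S" "finite T"
  shows "(\<lambda>x. (F x, G x)) \<in> measurable M (count_space (S \<times> T))"
  using measurable_Pair[OF assms(1,2)] assms(3,4)
  by (simp add: pair_measure_countable countable_finite)

lemma entropy_over_reindex:
  assumes "inj_on h S" "\<And>\<omega>. \<omega> \<in> space M \<Longrightarrow> Y \<omega> \<in> S"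
  shows "entropy_over b M (h ` S) (\<lambda>\<omega>. h (Y \<omega>)) = entropy_over b M S Y"
proof -
  have "{\<omega> \<in> space M. h (Y \<omega>) = h x} = {\<omega> \<in> space M. Y \<omega> = x}" if "x \<in> S" for x
    using assms that by (auto dest: inj_onD)
  then show ?thesis
    unfolding entropy_over_def by (subst sum.reindex[OF assms(1)]) (auto intro!: sum.cong)
qed

lemma entropy_over_distr:
  assumes h: "h \<in> measurable M N" and Y: "Y \<in> measurable N (count_space S)"
  shows "entropy_over b (distr M N h) S Y = entropy_over b M S (\<lambda>\<omega>. Y (h \<omega>))"
proof -
  have "measure (distr M N h) {\<omega> \<in> space N. Y \<omega> = x} = measure M {\<omega> \<in> space M. Y (h \<omega>) = x}"
    if "x \<in> S" for x
  proof -
    have "{\<omega> \<in> space N. Y \<omega> = x} = Y -` {x} \<inter> space N" by auto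
    also have "\<dots> \<in> sets N" using Y that by (intro measurable_sets) auto
    finally show ?thesis using measurable_space[OF h]
      by (subst measure_distr[OF h]) (auto intro!: arg_cong[where f="measure M"])
  qed
  then show ?thesis unfolding entropy_over_def by (auto intro!: sum.cong)
qed

section \<open>Information gained from one coordinate of a product\<close>

text \<open>
  This is the mutual information \<open>H(Y) - H(Y | T)\<close> of \<open>Y\<close> with the first coordinate \<open>T\<close>, which may have
  any distribution; conditioning on \<open>T\<close> amounts to fixing the first argument of \<open>Y\<close>.
\<close>

definition info_gain :: "real \<Rightarrow> 'a measure \<Rightarrow> 'b measure \<Rightarrow> 'c set \<Rightarrow> ('a \<times> 'b \<Rightarrow> 'c) \<Rightarrow> real" where
  "info_gain b A B S Y = entropy_over b (A \<Otimes>\<^sub>M B) S Y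
     - (\<integral>t. entropy_over b B S (\<lambda>w. Y (t, w)) \<partial>A)"

context pair_prob_space
begin

lemma section_prob:
  assumes Y: "Y \<in> measurable (M1 \<Otimes>\<^sub>M M2) (count_space S)" and x: "x \<in> S"
  shows "(\<lambda>t. M2.prob {w \<in> space M2. Y (t, w) = x}) \<in> borel_measurable M1" (is ?m)
    and "measure (M1 \<Otimes>\<^sub>M M2) {z \<in> space (M1 \<Otimes>\<^sub>M M2). Y z = x}
      = (\<integral>t. M2.prob {w \<in> space M2. Y (t, w) = x} \<partial>M1)" (is ?i)
proof -
  let ?A = "{z \<in> space (M1 \<Otimes>\<^sub>M M2). Y z = x}"
  have "?A = Y -` {x} \<inter> space (M1 \<Otimes>\<^sub>M M2)" by auto
  also have "\<dots> \<in> sets (M1 \<Otimes>\<^sub>M M2)" using Y x by (intro measurable_sets) auto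
  finally have A: "?A \<in> sets (M1 \<Otimes>\<^sub>M M2)" .
  have sec: "Pair t -` ?A = {w \<in> space M2. Y (t, w) = x}" if "t \<in> space M1" for t
    using that by (auto simp: space_pair_measure)
  have "(\<lambda>t. enn2real (emeasure M2 (Pair t -` ?A))) \<in> borel_measurable M1"
    using M2.measurable_emeasure_Pair[OF A] by measurable
  also have "?this \<longleftrightarrow> ?m"
    by (intro measurable_cong) (simp only: sec measure_def)
  finally show m: ?m .
  have "emeasure (M1 \<Otimes>\<^sub>M M2) ?A = (\<integral>\<^sup>+ t. emeasure M2 (Pair t -` ?A) \<partial>M1)"
    by (rule M2.emeasure_pair_measure_alt[OF A])
  also have "\<dots> = (\<integral>\<^sup>+ t. ennreal (M2.prob {w \<in> space M2. Y (t, w) = x}) \<partial>M1)"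
    by (intro nn_integral_cong) (simp only: sec M2.emeasure_eq_measure)
  finally show ?i
    using m by (subst integral_eq_nn_integral) (auto simp: measure_def)
qed

lemma measurable_section:
  assumes "Y \<in> measurable (M1 \<Otimes>\<^sub>M M2) K" "t \<in> space M1"
  shows "(\<lambda>w. Y (t, w)) \<in> measurable M2 K"
  using measurable_compose[OF measurable_Pair1'[OF assms(2)] assms(1)] .

lemma integrable_section_entropy:
  assumes b: "1 < b" and Y: "Y \<in> measurable (M1 \<Otimes>\<^sub>M M2) (count_space S)"
  shows "integrable M1 (\<lambda>t. entropy_over b M2 S (\<lambda>w. Y (t, w)))"
  unfolding entropy_over_def mult_minus_left
  by (intro Bochner_Integration.integrable_sum Bochner_Integration.integrable_minus
      M1.integrable_mult_log[OF b] section_prob(1)[OF Y]) auto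

text \<open>
  A pair carries at least as much information about the first coordinate as its component \<open>Y1\<close>. By the
  chain rule, applied on the product and on every section, this says \<open>H(Y2 | Y1) \<ge> H(Y2 | Y1, T)\<close>.
  The probabilities \<open>P\<close>, \<open>Q\<close> on the product are the means of the probabilities \<open>p\<close>, \<open>q\<close> on the sections,
  so each term is an instance of the Jensen inequality above.
\<close>

lemma info_gain_pair_ge_fst:
  assumes b: "1 < b"
    and Y1: "Y1 \<in> measurable (M1 \<Otimes>\<^sub>M M2) (count_space S1)"
    and Y2: "Y2 \<in> measurable (M1 \<Otimes>\<^sub>M M2) (count_space S2)"
    and fin: "finite S1" "finite S2"
  shows "info_gain b M1 M2 S1 Y1 \<le> info_gain b M1 M2 (S1 \<times> S2) (\<lambda>z. (Y1 z, Y2 z))"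
proof -
  let ?p = "\<lambda>x y t. M2.prob {w \<in> space M2. (Y1 (t, w), Y2 (t, w)) = (x, y)}"
  let ?q = "\<lambda>x t. M2.prob {w \<in> space M2. Y1 (t, w) = x}"
  let ?P = "\<lambda>x y. prob {z \<in> space (M1 \<Otimes>\<^sub>M M2). (Y1 z, Y2 z) = (x, y)}"
  let ?Q = "\<lambda>x. prob {z \<in> space (M1 \<Otimes>\<^sub>M M2). Y1 z = x}"
  let ?H2 = "\<lambda>t. entropy_over b M2 (S1 \<times> S2) (\<lambda>w. (Y1 (t, w), Y2 (t, w)))"
  let ?H1 = "\<lambda>t. entropy_over b M2 S1 (\<lambda>w. Y1 (t, w))"
  let ?k = "\<lambda>x y t. ?p x y t * (log b (?p x y t) - log b (?q x t))"
  let ?K = "\<lambda>x y. ?P x y * (log b (?P x y) - log b (?Q x))"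
  have Y: "(\<lambda>z. (Y1 z, Y2 z)) \<in> measurable (M1 \<Otimes>\<^sub>M M2) (count_space (S1 \<times> S2))"
    by (rule measurable_Pair_count_space[OF Y1 Y2 fin])
  have pq: "0 \<le> ?p x y t \<and> ?p x y t \<le> ?q x t \<and> ?q x t \<le> 1"
    if "x \<in> S1" "t \<in> space M1" for x y t
  proof -
    have "{w \<in> space M2. Y1 (t, w) = x} = (\<lambda>w. Y1 (t, w)) -` {x} \<inter> space M2" by auto
    also have "\<dots> \<in> sets M2"
      using measurable_section[OF Y1 that(2)] that by (intro measurable_sets) auto
    finally show ?thesis by (auto intro!: M2.finite_measure_mono)
  qed
  have mp: "?p x y \<in> borel_measurable M1" and P: "?P x y = (\<integral>t. ?p x y t \<partial>M1)"
    if "x \<in> S1" "y \<in> S2" for x y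
    using section_prob[OF Y, of "(x, y)"] that by auto
  have mq: "?q x \<in> borel_measurable M1" and Q: "?Q x = (\<integral>t. ?q x t \<partial>M1)" if "x \<in> S1" for x
    using section_prob[OF Y1 that] by auto
  have ik: "integrable M1 (?k x y)" if "x \<in> S1" "y \<in> S2" for x y
  proof -
    have "integrable M1 (\<lambda>t. ?p x y t * log b (?p x y t))"
      by (intro M1.integrable_mult_log[OF b] mp that) (use pq[OF that(1)] in force)+
    moreover have "integrable M1 (\<lambda>t. ?p x y t * log b (?q x t))"
      by (intro M1.integrable_mult_log[OF b] mp mq that) (use pq[OF that(1)] in force)+
    ultimately show ?thesis
      using Bochner_Integration.integrable_diff by (fastforce simp: right_diff_distrib)
  qed
  have "(\<integral>t. ?H2 t \<partial>M1) - (\<integral>t. ?H1 t \<partial>M1) = (\<integral>t. ?H2 t - ?H1 t \<partial>M1)"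
    using integrable_section_entropy[OF b Y] integrable_section_entropy[OF b Y1] by simp
  also have "\<dots> = (\<integral>t. - (\<Sum>(x, y)\<in>S1 \<times> S2. ?k x y t) \<partial>M1)"
    by (intro Bochner_Integration.integral_cong refl M2.entropy_over_chain
        measurable_section[OF Y1] measurable_section[OF Y2] fin)
  also have "\<dots> = - (\<Sum>(x, y)\<in>S1 \<times> S2. \<integral>t. ?k x y t \<partial>M1)"
    using ik by (simp add: case_prod_beta Bochner_Integration.integral_sum mem_Times_iff)
  also have "\<dots> \<le> - (\<Sum>(x, y)\<in>S1 \<times> S2. ?K x y)"
  proof -
    have "?K x y \<le> (\<integral>t. ?k x y t \<partial>M1)" if "x \<in> S1" "y \<in> S2" for x y
      unfolding P[OF that] Q[OF that(1)]
      by (rule M1.integral_rel_entropy_ge[OF b mp[OF that] mq[OF that(1)] pq[OF that(1)]])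
    then show ?thesis by (auto intro!: sum_mono)
  qed
  also have "\<dots> = entropy_over b (M1 \<Otimes>\<^sub>M M2) (S1 \<times> S2) (\<lambda>z. (Y1 z, Y2 z))
      - entropy_over b (M1 \<Otimes>\<^sub>M M2) S1 Y1"
    by (rule entropy_over_chain[OF Y1 Y2 fin(2), symmetric])
  finally show ?thesis by (simp add: info_gain_def)
qed

lemma info_gain_reindex:
  assumes "inj_on h S" "Y \<in> measurable (M1 \<Otimes>\<^sub>M M2) (count_space S)"
  shows "info_gain b M1 M2 (h ` S) (\<lambda>z. h (Y z)) = info_gain b M1 M2 S Y"
proof -
  have "entropy_over b (M1 \<Otimes>\<^sub>M M2) (h ` S) (\<lambda>z. h (Y z)) = entropy_over b (M1 \<Otimes>\<^sub>M M2) S Y"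
    using measurable_space[OF assms(2)] by (intro entropy_over_reindex[OF assms(1)]) auto
  moreover have "entropy_over b M2 (h ` S) (\<lambda>w. h (Y (t, w))) = entropy_over b M2 S (\<lambda>w. Y (t, w))"
    if "t \<in> space M1" for t
    using measurable_space[OF measurable_section[OF assms(2) that]]
    by (intro entropy_over_reindex[OF assms(1)]) auto
  ultimately show ?thesis
    unfolding info_gain_def by (simp cong: Bochner_Integration.integral_cong)
qed

lemma info_gain_pair_ge_snd:
  assumes b: "1 < b"
    and Y1: "Y1 \<in> measurable (M1 \<Otimes>\<^sub>M M2) (count_space S1)"
    and Y2: "Y2 \<in> measurable (M1 \<Otimes>\<^sub>M M2) (count_space S2)"
    and fin: "finite S1" "finite S2"
  shows "info_gain b M1 M2 S2 Y2 \<le> info_gain b M1 M2 (S1 \<times> S2) (\<lambda>z. (Y1 z, Y2 z))"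
proof -
  have Y: "(\<lambda>z. (Y2 z, Y1 z)) \<in> measurable (M1 \<Otimes>\<^sub>M M2) (count_space (S2 \<times> S1))"
    by (rule measurable_Pair_count_space[OF Y2 Y1 fin(2,1)])
  have "info_gain b M1 M2 S2 Y2 \<le> info_gain b M1 M2 (S2 \<times> S1) (\<lambda>z. (Y2 z, Y1 z))"
    by (rule info_gain_pair_ge_fst[OF b Y2 Y1 fin(2,1)])
  also have "\<dots> = info_gain b M1 M2 (S1 \<times> S2) (\<lambda>z. (Y1 z, Y2 z))"
    using info_gain_reindex[OF inj_swap Y, of b] by (simp add: product_swap)
  finally show ?thesis .
qed

lemma info_gain_eq_0:
  assumes "Y \<in> measurable (M1 \<Otimes>\<^sub>M M2) (count_space S)" "\<And>t w. Y (t, w) = Y' w"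
  shows "info_gain b M1 M2 S Y = 0"
  using section_prob(2)[OF assms(1)] assms(2)
  by (simp add: info_gain_def entropy_over_def M1.prob_space)

text \<open>
  A constant carries no information, and pairing it with \<open>Y\<close> can only increase the gain.
\<close>

lemma info_gain_nonneg:
  assumes b: "1 < b"
    and Y: "Y \<in> measurable (M1 \<Otimes>\<^sub>M M2) (count_space S)" and "finite S"
  shows "0 \<le> info_gain b M1 M2 S Y"
proof -
  have u: "(\<lambda>z. ()) \<in> measurable (M1 \<Otimes>\<^sub>M M2) (count_space {()})" by simp
  have "0 = info_gain b M1 M2 {()} (\<lambda>z. ())"
    by (rule info_gain_eq_0[OF u, symmetric]) simp
  also have "\<dots> \<le> info_gain b M1 M2 ({()} \<times> S) (\<lambda>z. ((), Y z))"
    by (rule info_gain_pair_ge_fst[OF b u Y]) (use \<open>finite S\<close> in auto)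
  also have "\<dots> = info_gain b M1 M2 (Pair () ` S) (\<lambda>z. ((), Y z))"
    by (rule arg_cong[where f="\<lambda>A. info_gain b M1 M2 A _"]) auto
  also have "\<dots> = info_gain b M1 M2 S Y"
    by (rule info_gain_reindex[OF _ Y]) (simp add: inj_on_def)
  finally show ?thesis .
qed

end

section \<open>The edge inequality on a product space\<close>

lemma entropy_over_PiM_empty: "entropy_over b (PiM {} N) S Y = 0"
proof -
  have "measure (PiM {} N) {z \<in> space (PiM {} N). Y z = x} \<in> {0, 1}" for x
  proof -
    have "{z \<in> space (PiM {} N). Y z = x} = {} \<or> {z \<in> space (PiM {} N). Y z = x} = {\<lambda>_. undefined}"
      by (auto simp: space_PiM_empty)
    then show ?thesis
    proof (elim disjE)
      assume *: "{z \<in> space (PiM {} N). Y z = x} = {}"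
      show ?thesis unfolding * by simp
    next
      assume *: "{z \<in> space (PiM {} N). Y z = x} = {\<lambda>_. undefined}"
      show ?thesis unfolding * by (simp add: measure_def)
    qed
  qed
  then show ?thesis unfolding entropy_over_def by (intro sum.neutral) force
qed

text \<open>
  The graph enters only through \<open>expansion\<close>, an inequality about real weights \<open>a\<close> supported on a single
  \<open>W i\<close>. The induction splits off one coordinate \<open>i\<close>. Averaged over its value, the entropies of the
  sections satisfy the inequality by the induction hypothesis, since each section is again a family of
  functions of the remaining coordinates. What the entropies lose by this conditioning are the
  information gains: the gain of an edge is at least the maximum of the gains of its ends, and the gains
  of the vertices are weights supported on \<open>W i\<close>, so \<open>expansion\<close> controls the loss as well.
\<close>

lemma product_entropy_inequality:
  fixes X :: "'v \<Rightarrow> ('i \<Rightarrow> 'z) \<Rightarrow> 'c" and s t :: "'e \<Rightarrow> 'v"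
  assumes b: "1 < b" and I: "finite I" and prob: "\<And>i. i \<in> I \<Longrightarrow> prob_space (N i)"
    and fin: "\<And>v. v \<in> V \<Longrightarrow> finite (S v)"
    and ends: "\<And>e. e \<in> E \<Longrightarrow> s e \<in> V" "\<And>e. e \<in> E \<Longrightarrow> t e \<in> V"
    and expansion: "\<And>i a. i \<in> I \<Longrightarrow> (\<And>v. v \<in> V \<Longrightarrow> 0 \<le> a v) \<Longrightarrow> (\<And>v. v \<in> V - W i \<Longrightarrow> a v = 0) \<Longrightarrow>
        \<beta> * (\<Sum>v\<in>V. a v) \<le> (\<Sum>e\<in>E. max (a (s e)) (a (t e)))"
    and X: "\<And>v. v \<in> V \<Longrightarrow> X v \<in> measurable (PiM I N) (count_space (S v))"
    and locality: "\<And>v i z r. v \<in> V \<Longrightarrow> i \<in> I \<Longrightarrow> v \<notin> W i \<Longrightarrow> X v (z(i := r)) = X v z"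
  shows "\<beta> * (\<Sum>v\<in>V. entropy_over b (PiM I N) (S v) (X v))
    \<le> (\<Sum>e\<in>E. entropy_over b (PiM I N) (S (s e) \<times> S (t e)) (\<lambda>z. (X (s e) z, X (t e) z)))"
  using I prob expansion X locality
proof (induction I arbitrary: X rule: finite_induct)
  case empty
  show ?case by (simp add: entropy_over_PiM_empty)
next
  case (insert i J)
  let ?A = "N i" and ?B = "PiM J N"
  define Y where "Y v z = X v ((snd z)(i := fst z))" for v and z :: "'z \<times> ('i \<Rightarrow> 'z)"
  let ?H = "\<lambda>v. entropy_over b (?A \<Otimes>\<^sub>M ?B) (S v) (Y v)"
  let ?HE = "\<lambda>e. entropy_over b (?A \<Otimes>\<^sub>M ?B) (S (s e) \<times> S (t e)) (\<lambda>z. (Y (s e) z, Y (t e) z))"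
  let ?h = "\<lambda>v r. entropy_over b ?B (S v) (\<lambda>w. Y v (r, w))"
  let ?hE = "\<lambda>e r. entropy_over b ?B (S (s e) \<times> S (t e)) (\<lambda>w. (Y (s e) (r, w), Y (t e) (r, w)))"
  let ?a = "\<lambda>v. info_gain b ?A ?B (S v) (Y v)"
  let ?aE = "\<lambda>e. info_gain b ?A ?B (S (s e) \<times> S (t e)) (\<lambda>z. (Y (s e) z, Y (t e) z))"
  interpret A: prob_space ?A using insert.prems by simp
  interpret B: prob_space ?B using insert.prems by (intro prob_space_PiM) simp
  interpret pair_prob_space ?A ?B ..
  have upd: "(\<lambda>z. (snd z)(i := fst z)) \<in> measurable (?A \<Otimes>\<^sub>M ?B) (PiM (insert i J) N)"
    by (rule measurable_fun_upd[where J=J]) auto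
  have distr: "PiM (insert i J) N = distr (?A \<Otimes>\<^sub>M ?B) (PiM (insert i J) N) (\<lambda>z. (snd z)(i := fst z))"
    using distr_pair_PiM_eq_PiM[of J N i] insert.prems(1) by (simp add: case_prod_beta')
  have Y: "Y v \<in> measurable (?A \<Otimes>\<^sub>M ?B) (count_space (S v))" if "v \<in> V" for v
    unfolding Y_def using measurable_compose[OF upd insert.prems(3)[OF that]] .
  have H: "entropy_over b (PiM (insert i J) N) (S v) (X v) = ?H v" if "v \<in> V" for v
    unfolding Y_def
    by (subst distr) (rule entropy_over_distr[OF upd insert.prems(3)[OF that]])
  have HE: "entropy_over b (PiM (insert i J) N) (S (s e) \<times> S (t e)) (\<lambda>z. (X (s e) z, X (t e) z)) = ?HE e"
    if "e \<in> E" for e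
    unfolding Y_def
    by (subst distr, rule entropy_over_distr[OF upd measurable_Pair_count_space])
       (use that ends fin insert.prems(3) in auto)
  have int: "integrable ?A (?h v)" if "v \<in> V" for v
    by (rule integrable_section_entropy[OF b Y[OF that]])
  have intE: "integrable ?A (?hE e)" if "e \<in> E" for e
    by (rule integrable_section_entropy[OF b measurable_Pair_count_space])
       (use Y fin ends that in auto)
  \<comment> \<open>The part of the entropy that is left once coordinate \<open>i\<close> is known.\<close>
  have IH: "\<beta> * (\<Sum>v\<in>V. ?h v r) \<le> (\<Sum>e\<in>E. ?hE e r)" if r: "r \<in> space ?A" for r
  proof (rule insert.IH)
    show "(\<lambda>w. Y v (r, w)) \<in> measurable ?B (count_space (S v))" if "v \<in> V" for v
      by (rule measurable_section[OF Y[OF that] r])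
    show "Y v (r, z(j := q)) = Y v (r, z)" if "v \<in> V" "j \<in> J" "v \<notin> W j" for v j z q
    proof -
      have "i \<noteq> j" using insert.hyps that by auto
      then have "(z(j := q))(i := r) = (z(i := r))(j := q)" by (simp add: fun_upd_twist)
      then show ?thesis using insert.prems(4)[of v j "z(i := r)" q] that
        by (simp only: Y_def fst_conv snd_conv) blast
    qed
    show "prob_space (N j)" if "j \<in> J" for j
      using insert.prems(1) that by simp
    show "\<beta> * (\<Sum>v\<in>V. a v) \<le> (\<Sum>e\<in>E. max (a (s e)) (a (t e)))"
      if "j \<in> J" "\<And>v. v \<in> V \<Longrightarrow> 0 \<le> a v" "\<And>v. v \<in> V - W j \<Longrightarrow> a v = 0" for j a
      using insert.prems(2)[OF insertI2[OF that(1)]] that(2,3) by blast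
  qed
  have "\<beta> * (\<Sum>v\<in>V. \<integral>r. ?h v r \<partial>?A) = (\<integral>r. \<beta> * (\<Sum>v\<in>V. ?h v r) \<partial>?A)"
    using int by (simp add: Bochner_Integration.integral_sum)
  also have "\<dots> \<le> (\<integral>r. (\<Sum>e\<in>E. ?hE e r) \<partial>?A)"
    using int intE IH by (intro integral_mono) auto
  also have "\<dots> = (\<Sum>e\<in>E. \<integral>r. ?hE e r \<partial>?A)"
    using intE by (rule Bochner_Integration.integral_sum)
  finally have tail: "\<beta> * (\<Sum>v\<in>V. \<integral>r. ?h v r \<partial>?A) \<le> (\<Sum>e\<in>E. \<integral>r. ?hE e r \<partial>?A)" .
  \<comment> \<open>The part of the entropy that coordinate \<open>i\<close> accounts for.\<close>
  have "\<beta> * (\<Sum>v\<in>V. ?a v) \<le> (\<Sum>e\<in>E. max (?a (s e)) (?a (t e)))"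
  proof (rule insert.prems(2)[of i])
    show "0 \<le> ?a v" if "v \<in> V" for v
      by (rule info_gain_nonneg[OF b Y[OF that] fin[OF that]])
    show "?a v = 0" if "v \<in> V - W i" for v
    proof (rule info_gain_eq_0[where Y'="X v"])
      show "Y v \<in> measurable (?A \<Otimes>\<^sub>M ?B) (count_space (S v))" using Y that by simp
      show "Y v (r, w) = X v w" for r w
        using insert.prems(4)[of v i w r] that by (simp only: Y_def fst_conv snd_conv) blast
    qed
  qed simp
  also have "\<dots> \<le> (\<Sum>e\<in>E. ?aE e)"
    using info_gain_pair_ge_fst[OF b Y Y fin fin] info_gain_pair_ge_snd[OF b Y Y fin fin] ends
    by (intro sum_mono max.boundedI) auto
  finally have head: "\<beta> * (\<Sum>v\<in>V. ?a v) \<le> (\<Sum>e\<in>E. ?aE e)" .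
  have "\<beta> * (\<Sum>v\<in>V. ?H v) = \<beta> * (\<Sum>v\<in>V. ?a v) + \<beta> * (\<Sum>v\<in>V. \<integral>r. ?h v r \<partial>?A)"
    by (simp add: info_gain_def sum_subtractf algebra_simps)
  also have "\<dots> \<le> (\<Sum>e\<in>E. ?aE e) + (\<Sum>e\<in>E. \<integral>r. ?hE e r \<partial>?A)"
    using head tail by (rule add_mono)
  also have "\<dots> = (\<Sum>e\<in>E. ?HE e)"
    by (simp add: info_gain_def sum_subtractf)
  finally show ?case by (simp add: H HE)
qed

section \<open>From vertex sets to weights on the vertices\<close>

text \<open>
  Both sides are additive over the layers of \<open>a\<close>: if \<open>a\<close> is a combination, with positive coefficients,
  of indicators of a decreasing chain of sets, then so is the maximum over an edge, with the indicator of
  the event that the edge meets the set. It is therefore enough to know the inequality for indicators.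
  The induction removes the lowest layer, the smallest positive value \<open>c\<close> on the support \<open>U\<close>.
\<close>

lemma layer_cake_edge_max:
  fixes a :: "'v \<Rightarrow> real" and s t :: "'e \<Rightarrow> 'v"
  assumes fin: "finite V" "finite E"
    and ends: "\<And>e. e \<in> E \<Longrightarrow> s e \<in> V" "\<And>e. e \<in> E \<Longrightarrow> t e \<in> V"
    and level: "\<And>U. U \<subseteq> A \<Longrightarrow> U \<noteq> {} \<Longrightarrow> \<beta> * real (card U) \<le> real (card {e \<in> E. s e \<in> U \<or> t e \<in> U})"
    and nonneg: "\<And>v. v \<in> V \<Longrightarrow> 0 \<le> a v" and supp: "\<And>v. v \<in> V - A \<Longrightarrow> a v = 0"
  shows "\<beta> * (\<Sum>v\<in>V. a v) \<le> (\<Sum>e\<in>E. max (a (s e)) (a (t e)))"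
  using nonneg supp
proof (induction "card {v \<in> V. 0 < a v}" arbitrary: a rule: less_induct)
  case less
  define U where "U = {v \<in> V. 0 < a v}"
  have out: "a v = 0" if "v \<in> V" "v \<notin> U" for v
    using less.prems(1)[of v] that by (auto simp: U_def)
  show ?case
  proof (cases "U = {}")
    case True
    then show ?thesis using out ends by simp
  next
    case False
    have finU: "finite U" using fin by (simp add: U_def)
    define c where "c = Min (a ` U)"
    define a' where "a' v = (if v \<in> U then a v - c else a v)" for v
    have "c \<in> a ` U" unfolding c_def using finU False by (intro Min_in) auto
    then obtain v0 where v0: "v0 \<in> U" "a v0 = c" by auto
    have c: "0 < c" using v0 by (auto simp: U_def)
    have cle: "c \<le> a v" if "v \<in> U" for v unfolding c_def using finU that by simp
    have "{v \<in> V. 0 < a' v} \<subset> U"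
      using v0 out by (auto simp: a'_def U_def split: if_splits)
    then have "card {v \<in> V. 0 < a' v} < card {v \<in> V. 0 < a v}"
      unfolding U_def[symmetric] by (rule psubset_card_mono[OF finU])
    then have IH: "\<beta> * (\<Sum>v\<in>V. a' v) \<le> (\<Sum>e\<in>E. max (a' (s e)) (a' (t e)))"
      by (rule less.hyps) (use less.prems cle in \<open>auto simp: a'_def U_def\<close>)
    have UA: "U \<subseteq> A" using less.prems(2) by (force simp: U_def)
    have "U \<subseteq> V" by (auto simp: U_def)
    then have sumU: "(\<Sum>v\<in>V. if v \<in> U then c else 0) = c * real (card U)"
      using fin by (simp add: sum.inter_restrict[symmetric] Int_absorb1)
    have "(\<Sum>v\<in>V. a v) = (\<Sum>v\<in>V. a' v) + c * real (card U)"
      unfolding sumU[symmetric] sum.distrib[symmetric] by (auto simp: a'_def intro!: sum.cong)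
    then have "\<beta> * (\<Sum>v\<in>V. a v) = \<beta> * (\<Sum>v\<in>V. a' v) + c * (\<beta> * real (card U))"
      by (simp add: algebra_simps)
    also have "\<dots> \<le> (\<Sum>e\<in>E. max (a' (s e)) (a' (t e))) + c * real (card {e \<in> E. s e \<in> U \<or> t e \<in> U})"
      using IH level[OF UA False] c by (intro add_mono mult_left_mono) auto
    also have "\<dots> = (\<Sum>e\<in>E. max (a' (s e)) (a' (t e)) + (if s e \<in> U \<or> t e \<in> U then c else 0))"
      using fin by (simp add: sum.distrib sum.inter_filter[symmetric])
    also have "\<dots> = (\<Sum>e\<in>E. max (a (s e)) (a (t e)))"
    proof (rule sum.cong[OF refl])
      fix e assume "e \<in> E"
      then show "max (a' (s e)) (a' (t e)) + (if s e \<in> U \<or> t e \<in> U then c else 0) = max (a (s e)) (a (t e))"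
        using cle[of "s e"] cle[of "t e"] out[of "s e"] out[of "t e"] ends[of e] c
        by (auto simp: a'_def max_def)
    qed
    finally show ?thesis .
  qed
qed

lemma regular_graph_finite_edges:
  assumes "regular_graph d V E"
  shows "finite E"
proof (rule finite_subset)
  show "E \<subseteq> Pow V"
    using assms unfolding regular_graph_def simple_graph_def by fastforce
  show "finite (Pow V)"
    using assms by (simp add: regular_graph_def)
qed

text \<open>
  Counting incidences between \<open>U\<close> and the edges gives \<open>d * card U\<close>; there an edge inside \<open>U\<close> counts twice
  and a boundary edge once. Adding the boundary makes every edge that meets \<open>U\<close> count twice.
\<close>

lemma regular_graph_boundary_count:
  assumes G: "regular_graph d V E" and "U \<subseteq> V"
  shows "d * card U + card (edge_boundary E U) = 2 * card {e \<in> E. e \<inter> U \<noteq> {}}"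
proof -
  have fV: "finite V" using G by (simp add: regular_graph_def)
  have sE: "\<exists>u v. u \<in> V \<and> v \<in> V \<and> u \<noteq> v \<and> e = {u, v}" if "e \<in> E" for e
    using G that unfolding regular_graph_def simple_graph_def by meson
  have fE: "finite E" using G by (rule regular_graph_finite_edges)
  have fU: "finite U" using assms fV by (auto intro: finite_subset)
  have "(\<Sum>e\<in>E. card {v \<in> U. v \<in> e}) = (\<Sum>v\<in>U. d)"
    using assms fE fU by (intro sum_multicount_gen) (auto simp: regular_graph_def)
  moreover have "card (edge_boundary E U) = (\<Sum>e\<in>E. if e \<in> edge_boundary E U then 1 else 0)"
    using fE by (simp add: sum.inter_filter[symmetric])
       (auto intro!: arg_cong[where f=card] simp: edge_boundary_def)
  moreover have "2 * card {e \<in> E. e \<inter> U \<noteq> {}} = (\<Sum>e\<in>E. if e \<inter> U \<noteq> {} then 2 else 0)"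
    using fE by (simp add: sum.inter_filter[symmetric])
  moreover have "card {v \<in> U. v \<in> e} + (if e \<in> edge_boundary E U then 1 else 0)
      = (if e \<inter> U \<noteq> {} then 2 else 0)" if e: "e \<in> E" for e
  proof -
    obtain u v where uv: "u \<noteq> v" "e = {u, v}" using sE[OF e] by blast
    have bd: "e \<in> edge_boundary E U \<longleftrightarrow> (u \<in> U) \<noteq> (v \<in> U)"
      using e unfolding edge_boundary_def uv(2) by (auto simp: doubleton_eq_iff)
    have "{w \<in> U. w \<in> e} = (if u \<in> U then {u} else {}) \<union> (if v \<in> U then {v} else {})"
      unfolding uv(2) by auto
    then have "card {w \<in> U. w \<in> e} = (if u \<in> U then 1 else 0) + (if v \<in> U then 1 else 0)"
      by (simp only:) (use uv(1) in simp)
    moreover have "e \<inter> U \<noteq> {} \<longleftrightarrow> u \<in> U \<or> v \<in> U" unfolding uv(2) by auto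
    ultimately show ?thesis by (simp only: bd) simp
  qed
  then have "(\<Sum>e\<in>E. card {v \<in> U. v \<in> e}) + (\<Sum>e\<in>E. if e \<in> edge_boundary E U then 1 else 0)
      = (\<Sum>e\<in>E. if e \<inter> U \<noteq> {} then 2 else 0)"
    unfolding sum.distrib[symmetric] by (rule sum.cong[OF refl])
  ultimately show ?thesis by (simp add: mult.commute)
qed

section \<open>The entropy inequality for factors of independent variables\<close>

text \<open>
  Once each edge is given an orientation from \<open>s e\<close> to \<open>t e\<close>, the sum over edges needs no description
  operator.
\<close>

lemma edge_sum_eq:
  assumes "\<And>e. e \<in> E \<Longrightarrow> e = {s e, t e} \<and> f (s e) (t e) = f (t e) (s e)"
  shows "edge_sum E f = (\<Sum>e\<in>E. f (s e) (t e))"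
  unfolding edge_sum_def
proof (rule sum.cong[OF refl])
  fix e assume "e \<in> E"
  from assms[OF this] obtain u v where uv: "s e = u" "t e = v" and e: "e = {u, v}"
    and sym: "f u v = f v u" by metis
  show "(THE y. \<exists>u v. e = {u, v} \<and> y = f u v) = f (s e) (t e)"
    unfolding uv unfolding e by (rule edge_value_eq[of f, OF sym])
qed

lemma simple_function_count_space:
  assumes Y: "Y \<in> measurable M (count_space S)" and "finite S"
  shows "simple_function M Y"
  unfolding simple_function_def
proof (intro conjI ballI)
  have sub: "Y ` space M \<subseteq> S" using measurable_space[OF Y] by auto
  then show "finite (Y ` space M)" using \<open>finite S\<close> by (rule finite_subset)
  show "Y -` {x} \<inter> space M \<in> sets M" if "x \<in> Y ` space M" for x
    using sub that by (intro measurable_sets[OF Y]) auto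
qed

lemma (in information_space) shannon_entropy_eq_entropy_over:
  assumes Y: "Y \<in> measurable M (count_space S)" and "finite S"
  shows "shannon_entropy b M Y = entropy_over b M S Y"
proof -
  have "prob {\<omega> \<in> space M. Y \<omega> = x} = 0" if "x \<in> S - Y ` space M" for x
  proof -
    have "{\<omega> \<in> space M. Y \<omega> = x} = {}" using that by auto
    then show ?thesis by (simp only: measure_empty)
  qed
  then show ?thesis
    unfolding entropy_over_def shannon_entropy_eq[OF simple_function_count_space[OF assms]]
    using measurable_space[OF Y] \<open>finite S\<close> by (intro sum.mono_neutral_left) auto
qed

theorem theorem1:
  fixes V :: "'v set" and E :: "'v set set" and d m :: nat
    and M :: "'a measure" and b :: real
    and N :: "nat \<Rightarrow> 'z measure" and Z :: "nat \<Rightarrow> 'a \<Rightarrow> 'z"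
    and W :: "nat \<Rightarrow> 'v set"
    and S :: "'v \<Rightarrow> 'c set" and X :: "'v \<Rightarrow> 'a \<Rightarrow> 'c"
  assumes graph: "regular_graph d V E"
    and prob: "prob_space M"
    and base: "1 < b"
    and indep: "prob_space.indep_vars M N Z {1..m}"
    and subsets: "\<forall>i\<in>{1..m}. W i \<subseteq> V"
    and nonempty: "\<exists>i\<in>{1..m}. W i \<noteq> {}"
    and finite_range: "\<forall>v\<in>V. finite (S v)"
    and function_of_Z: "\<forall>v\<in>V. \<exists>g \<in> measurable (PiM {i \<in> {1..m}. v \<in> W i} N) (count_space (S v)).
           \<forall>\<omega>\<in>space M. X v \<omega> = g (\<lambda>i\<in>{i \<in> {1..m}. v \<in> W i}. Z i \<omega>)"
  shows "edge_sum E (\<lambda>u v. shannon_entropy b M (\<lambda>\<omega>. (X u \<omega>, X v \<omega>)))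
     \<ge> 1 / 2 * (real d + Min {real (card (edge_boundary E U)) / real (card U) | i U.
                              i \<in> {1..m} \<and> U \<subseteq> W i \<and> U \<noteq> {}})
        * (\<Sum>v\<in>V. shannon_entropy b M (X v))"
proof -
  interpret information_space M b
    using prob base by (intro information_space.intro information_space_axioms.intro)
  let ?I = "{1..m}"
  let ?R = "{real (card (edge_boundary E U)) / real (card U) | i U. i \<in> ?I \<and> U \<subseteq> W i \<and> U \<noteq> {}}"
  define \<beta> where "\<beta> = 1 / 2 * (real d + Min ?R)"
  define J where "J v = {i \<in> ?I. v \<in> W i}" for v

  have fV: "finite V" using graph by (simp add: regular_graph_def)
  have "\<forall>e\<in>E. \<exists>u v. u \<in> V \<and> v \<in> V \<and> e = {u, v}"
    using graph unfolding regular_graph_def simple_graph_def by blast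
  then obtain s t where st: "\<And>e. e \<in> E \<Longrightarrow> s e \<in> V \<and> t e \<in> V \<and> e = {s e, t e}"
    by metis
  have fE: "finite E" using graph by (rule regular_graph_finite_edges)

  have finR: "finite ?R"
  proof (rule finite_subset)
    show "?R \<subseteq> (\<lambda>U. real (card (edge_boundary E U)) / real (card U)) ` Pow V"
      using subsets by blast
  qed (use fV in simp)
  \<comment> \<open>This is where the value of \<open>\<beta>\<close> comes from: the number of edges meeting \<open>U\<close> is half of
     \<open>d * card U + card (edge_boundary E U)\<close>.\<close>
  have level: "\<beta> * real (card U) \<le> real (card {e \<in> E. s e \<in> U \<or> t e \<in> U})"
    if i: "i \<in> ?I" and U: "U \<subseteq> W i" "U \<noteq> {}" for i U
  proof -
    have UV: "U \<subseteq> V" using subsets i U by blast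
    then have cU: "0 < card U" using U fV by (simp add: card_gt_0_iff finite_subset)
    have "Min ?R \<le> real (card (edge_boundary E U)) / real (card U)"
      using finR i U by (intro Min_le) auto
    then have bound: "Min ?R * real (card U) \<le> real (card (edge_boundary E U))"
      using cU by (simp add: field_simps)
    have "s e \<in> U \<or> t e \<in> U \<longleftrightarrow> e \<inter> U \<noteq> {}" if "e \<in> E" for e
      using arg_cong[OF conjunct2[OF conjunct2[OF st[OF that]]], of "\<lambda>x. x \<inter> U"] by auto
    then have "{e \<in> E. s e \<in> U \<or> t e \<in> U} = {e \<in> E. e \<inter> U \<noteq> {}}" by blast
    moreover have "real d * real (card U) + real (card (edge_boundary E U))
        = 2 * real (card {e \<in> E. e \<inter> U \<noteq> {}})"
      using arg_cong[OF regular_graph_boundary_count[OF graph UV], of real] by simp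
    ultimately show ?thesis using bound by (simp add: \<beta>_def algebra_simps)
  qed

  have Zm: "Z i \<in> measurable M (N i)" if "i \<in> ?I" for i
    using indep that by (auto simp: indep_vars_def)
  \<comment> \<open>By independence the joint law of the \<open>Z i\<close> is a product measure, and every \<open>X v\<close> becomes a
     function on that product which reads only the coordinates in \<open>J v\<close>.\<close>
  define D where "D = (\<lambda>i. distr M (N i) (Z i))"
  let ?Z = "\<lambda>\<omega>. \<lambda>i\<in>?I. Z i \<omega>"
  have "?I \<noteq> {}" using nonempty by blast
  then have joint: "distr M (PiM ?I N) ?Z = PiM ?I D"
    using indep_vars_iff_distr_eq_PiM'[of ?I Z N] Zm indep by (simp add: D_def)
  have ZD: "?Z \<in> measurable M (PiM ?I D)"
    using Zm by (intro measurable_restrict) (simp add: D_def)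
  have setsD: "sets (PiM K D) = sets (PiM K N)" for K
    by (rule sets_PiM_cong[OF refl]) (simp add: D_def)
  have "\<forall>v\<in>V. \<exists>g. g \<in> measurable (PiM (J v) N) (count_space (S v)) \<and>
      (\<forall>\<omega>\<in>space M. X v \<omega> = g (\<lambda>i\<in>J v. Z i \<omega>))"
    using function_of_Z unfolding J_def Bex_def .
  from bchoice[OF this] obtain g where g: "\<And>v. v \<in> V \<Longrightarrow> g v \<in> measurable (PiM (J v) N) (count_space (S v))"
    and Xg: "\<And>v \<omega>. v \<in> V \<Longrightarrow> \<omega> \<in> space M \<Longrightarrow> X v \<omega> = g v (\<lambda>i\<in>J v. Z i \<omega>)"
    by blast
  define Y where "Y v z = g v (restrict z (J v))" for v z
  have Y: "Y v \<in> measurable (PiM ?I D) (count_space (S v))" if "v \<in> V" for v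
  proof -
    have "(\<lambda>z. restrict z (J v)) \<in> measurable (PiM ?I D) (PiM (J v) D)"
      by (rule measurable_restrict_subset) (auto simp: J_def)
    moreover have "g v \<in> measurable (PiM (J v) D) (count_space (S v))"
      using g[OF that] by (subst measurable_cong_sets[OF setsD refl])
    ultimately show ?thesis unfolding Y_def by (rule measurable_compose)
  qed
  have XY: "X v \<omega> = Y v (?Z \<omega>)" if "v \<in> V" "\<omega> \<in> space M" for v \<omega>
    using Xg[OF that] by (auto simp: Y_def J_def restrict_def intro!: arg_cong[where f="g v"])
  have X: "X v \<in> measurable M (count_space (S v))" if "v \<in> V" for v
    using measurable_compose[OF ZD Y[OF that]] XY[OF that] by (simp cong: measurable_cong)

  have transfer: "shannon_entropy b M F = entropy_over b (PiM ?I D) T G"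
    if "finite T" "F \<in> measurable M (count_space T)" "G \<in> measurable (PiM ?I D) (count_space T)"
      "\<And>\<omega>. \<omega> \<in> space M \<Longrightarrow> F \<omega> = G (?Z \<omega>)" for F and T :: "'t set" and G
  proof -
    have "shannon_entropy b M F = entropy_over b M T F"
      by (rule shannon_entropy_eq_entropy_over[OF that(2,1)])
    also have "\<dots> = entropy_over b M T (\<lambda>\<omega>. G (?Z \<omega>))"
      by (simp add: entropy_over_def that(4) cong: conj_cong)
    also have "\<dots> = entropy_over b (distr M (PiM ?I D) ?Z) T G"
      by (rule entropy_over_distr[OF ZD that(3), symmetric])
    also have "distr M (PiM ?I D) ?Z = PiM ?I D"
      unfolding joint[symmetric] by (intro distr_cong) (simp_all add: setsD)
    finally show ?thesis .
  qed

  have "\<beta> * (\<Sum>v\<in>V. shannon_entropy b M (X v)) = \<beta> * (\<Sum>v\<in>V. entropy_over b (PiM ?I D) (S v) (Y v))"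
    by (intro arg_cong[where f="(*) \<beta>"] sum.cong refl transfer) (use finite_range X Y XY in auto)
  also have "\<dots> \<le> (\<Sum>e\<in>E. entropy_over b (PiM ?I D) (S (s e) \<times> S (t e)) (\<lambda>z. (Y (s e) z, Y (t e) z)))"
  proof (rule product_entropy_inequality[where W=W])
    show "prob_space (D i)" if "i \<in> ?I" for i
      unfolding D_def by (rule prob_space_distr[OF Zm[OF that]])
    show "\<beta> * (\<Sum>v\<in>V. a v) \<le> (\<Sum>e\<in>E. max (a (s e)) (a (t e)))"
      if "i \<in> ?I" "\<And>v. v \<in> V \<Longrightarrow> 0 \<le> a v" "\<And>v. v \<in> V - W i \<Longrightarrow> a v = 0" for i a
      using that st by (intro layer_cake_edge_max[OF fV fE _ _ level[OF that(1)]]) auto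
    show "Y v (z(i := r)) = Y v z" if "v \<in> V" "i \<in> ?I" "v \<notin> W i" for v i z r
    proof -
      have "restrict (z(i := r)) (J v) = restrict z (J v)" using that by (auto simp: J_def)
      then show ?thesis by (simp only: Y_def)
    qed
  qed (use base finite_range st Y in auto)
  also have "\<dots> = (\<Sum>e\<in>E. shannon_entropy b M (\<lambda>\<omega>. (X (s e) \<omega>, X (t e) \<omega>)))"
    by (intro sum.cong refl transfer[symmetric] measurable_Pair_count_space) (use finite_range st X Y XY in auto)
  also have "\<dots> = edge_sum E (\<lambda>u v. shannon_entropy b M (\<lambda>\<omega>. (X u \<omega>, X v \<omega>)))"
    using st X finite_range
    by (intro edge_sum_eq[symmetric] conjI shannon_entropy_Pair_commute simple_function_count_space) auto
  finally show ?thesis by (simp add: \<beta>_def)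
qed

end
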